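(* Let $\mathcal{D}$ be a dyadic lattice in $\mathbb{R}^d$ and let $\mathcal{S}\subset\mathcal{D}$ be a Carleson collection of cubes such that $\pi Q\in\mathcal{S}$ for each cube $Q\in\mathcal{S}$. Then $\mathcal{S}$ is well-sparse, and there exist two constants $\alpha>0$ and $\zeta>0$ such that for each cube $R\in\mathcal{D}$ $$\sum_{\substack{Q\in\mathcal{S}\\ Q\subset R}}|Q|^{1-\alpha/d}\leq\zeta\,|R|^{1-\alpha/d}.$$
   Context: $|A|$ denotes $d$-dimensional Lebesgue measure of $A$. A cube is a half-open set $Q=[a_1,b_1)\times\dots\times[a_d,b_d)$ with equal side lengths $\ell(Q)=b_1-a_1=\dots=b_d-a_d>0$. For a cube $R$, $\mathcal{D}(R)=\bigcup_{j\ge0}\mathcal{D}_j(R)$, where $\mathcal{D}_j(R)$ is the collection of the $2^{jd}$ pairwise disjoint half-open cubes of side length $2^{-j}\ell(R)$ whose union is $R$. A dyadic lattice $\mathcal{D}$ is a collection of cubes such that: (DL1) if $Q\in\mathcal{D}$ then $\mathcal{D}(Q)\subset\mathcal{D}$; (DL2) any two cubes $Q',Q''\in\mathcal{D}$ have a common ancestor, i.e. there is $Q\in\mathcal{D}$ with $Q',Q''\in\mathcal{D}(Q)$; (DL3) for every compact $K\subset\mathbb{R}^d$ there is a cube $Q\in\mathcal{D}$ containing $K$. For $Q\in\mathcal{D}$, $\pi Q$ is the unique cube in $\mathcal{D}$ with $Q\in\mathcal{D}_1(\pi Q)$. A collection $\mathcal{S}\subset\mathcal{D}$ is Carleson if there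 is a constant $\xi>0$ such that $\sum_{Q\in\mathcal{S},\,Q\subset R}|Q|\le\xi|R|$ for each cube $R\in\mathcal{D}$. A collection $\mathcal{S}\subset\mathcal{D}$ is well-sparse if there exist a constant $\lambda>1$ and a family of cubes $M(Q)\subset Q$, $Q\in\mathcal{S}$, such that $M(Q')\cap M(Q'')=\varnothing$ for $Q'\ne Q''$ and $\lambda|M(Q)|\ge|Q|$ for each $Q\in\mathcal{S}$. *)

theory Defs
  imports "HOL-Analysis.Analysis"
begin

definition cube :: "real ^ 'n \<Rightarrow> real \<Rightarrow> (real ^ 'n) set" where
  "cube a l = {x. \<forall>i. a $ i \<le> x $ i \<and> x $ i < a $ i + l}"

definition is_cube :: "(real ^ 'n) set \<Rightarrow> bool" where
  "is_cube Q \<longleftrightarrow> (\<exists>a l. l > 0 \<and> Q = cube a l)"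

definition side :: "(real ^ 'n) set \<Rightarrow> real" where
  "side Q = (THE l. l > 0 \<and> (\<exists>a. Q = cube a l))"

definition is_dyadic_partition :: "nat \<Rightarrow> (real ^ 'n) set \<Rightarrow> (real ^ 'n) set set \<Rightarrow> bool" where
  "is_dyadic_partition j R C \<longleftrightarrow>
     card C = 2 ^ (j * CARD('n)) \<and>
     (\<forall>Q\<in>C. is_cube Q \<and> side Q = side R / 2 ^ j) \<and>
     disjoint C \<and> \<Union>C = R"

text \<open>The partition is unique and has the expected grid form: see \<open>dyadic_gen_cube\<close>
  and \<open>is_dyadic_partition_iff\<close> below.\<close>

definition dyadic_gen :: "nat \<Rightarrow> (real ^ 'n) set \<Rightarrow> (real ^ 'n) set set" where
  "dyadic_gen j R = (THE C. is_dyadic_partition j R C)"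

definition dyadic_cubes :: "(real ^ 'n) set \<Rightarrow> (real ^ 'n) set set" where
  "dyadic_cubes R = (\<Union>j. dyadic_gen j R)"

definition dyadic_lattice :: "(real ^ 'n) set set \<Rightarrow> bool" where
  "dyadic_lattice D \<longleftrightarrow>
     (\<forall>Q\<in>D. is_cube Q) \<and>
     (\<forall>Q\<in>D. dyadic_cubes Q \<subseteq> D) \<and>
     (\<forall>Q'\<in>D. \<forall>Q''\<in>D. \<exists>Q\<in>D. Q' \<in> dyadic_cubes Q \<and> Q'' \<in> dyadic_cubes Q) \<and>
     (\<forall>K. compact K \<longrightarrow> (\<exists>Q\<in>D. K \<subseteq> Q))"

definition parent :: "(real ^ 'n) set set \<Rightarrow> (real ^ 'n) set \<Rightarrow> (real ^ 'n) set" where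
  "parent D Q = (THE P. P \<in> D \<and> Q \<in> dyadic_gen 1 P)"

abbreviation vol :: "(real ^ 'n) set \<Rightarrow> real" where
  "vol Q \<equiv> measure lebesgue Q"

text \<open>The sums are taken in \<^typ>\<open>ennreal\<close>, where every family is summable; over the reals a
  divergent sum would be \<open>0\<close>.\<close>

definition Carleson :: "(real ^ 'n) set set \<Rightarrow> (real ^ 'n) set set \<Rightarrow> bool" where
  "Carleson D S \<longleftrightarrow>
     (\<exists>\<xi>::real. \<xi> > 0 \<and>
       (\<forall>R\<in>D. (\<Sum>\<^sub>\<infinity>Q\<in>{Q \<in> S. Q \<subseteq> R}. ennreal (vol Q)) \<le> ennreal (\<xi> * vol R)))"

text \<open>The cubes \<open>M Q\<close> are not required to belong to any lattice.\<close>

definition well_sparse :: "(real ^ 'n) set set \<Rightarrow> bool" where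
  "well_sparse S \<longleftrightarrow>
     (\<exists>(c::real) M. c > 1 \<and>
       (\<forall>Q\<in>S. is_cube (M Q) \<and> M Q \<subseteq> Q) \<and>
       (\<forall>Q'\<in>S. \<forall>Q''\<in>S. Q' \<noteq> Q'' \<longrightarrow> M Q' \<inter> M Q'' = {}) \<and>
       (\<forall>Q\<in>S. c * vol (M Q) \<ge> vol Q))"

lemma cube_nonempty: "l > 0 \<Longrightarrow> a \<in> cube a l"
  by (simp add: cube_def)

lemma cube_line:
  fixes a c :: "real ^ 'n"
  assumes "c \<in> cube a l"
  shows "(\<chi> k. if k = i then t else c $ k) \<in> cube a l \<longleftrightarrow> a $ i \<le> t \<and> t < a $ i + l"
  using assms by (auto simp: cube_def)

lemma cube_inject:
  fixes a b :: "real ^ 'n"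
  assumes "l > 0" "m > 0"
  shows "cube a l = cube b m \<longleftrightarrow> a = b \<and> l = m"
proof
  assume eq: "cube a l = cube b m"
  have a: "a \<in> cube a l" "a \<in> cube b m" using cube_nonempty[OF assms(1)] eq by auto
  have b: "b \<in> cube b m" "b \<in> cube a l" using cube_nonempty[OF assms(2)] eq by auto
  have ab: "a = b"
    using a b by (auto simp: cube_def vec_eq_iff intro!: antisym)
  have iff: "(a $ i \<le> t \<and> t < a $ i + l) \<longleftrightarrow> (b $ i \<le> t \<and> t < b $ i + m)" for i t
    using cube_line[OF a(1), of i t] cube_line[OF a(2), of i t] eq by simp
  have "\<not> m < l" using iff[of undefined "a $ undefined + m"] ab assms by auto
  moreover have "\<not> l < m" using iff[of undefined "a $ undefined + l"] ab assms by auto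
  ultimately show "a = b \<and> l = m" using ab by auto
qed simp

lemma side_cube: "l > 0 \<Longrightarrow> side (cube a l) = l"
  unfolding side_def by (rule the_equality) (auto simp: cube_inject)

definition grid :: "nat \<Rightarrow> real ^ 'n \<Rightarrow> real \<Rightarrow> (real ^ 'n) set set" where
  "grid N a s = (\<lambda>k. cube (\<chi> i. a $ i + real (k i) * s) s) ` (UNIV \<rightarrow>\<^sub>E {..<N})"

lemma grid_inj:
  assumes "s > 0"
  shows "inj (\<lambda>k::'n::finite \<Rightarrow> nat. cube (\<chi> i. a $ i + real (k i) * s) s)"
  using assms by (auto simp: inj_def cube_inject vec_eq_iff fun_eq_iff)

lemma card_grid:
  assumes "s > 0"
  shows "card (grid N (a :: real ^ 'n) s) = N ^ CARD('n)"
proof -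
  have "card (grid N a s) = card ((UNIV :: 'n set) \<rightarrow>\<^sub>E {..<N})"
    unfolding grid_def by (rule card_image) (rule inj_on_subset[OF grid_inj[OF assms]], simp)
  then show ?thesis by (simp add: card_PiE)
qed

lemma floor_cell:
  fixes t s :: real
  assumes "s > 0" "0 \<le> t" "t < real N * s"
  shows "\<exists>m<N. real m * s \<le> t \<and> t < real m * s + s"
proof -
  let ?m = "nat \<lfloor>t / s\<rfloor>"
  have "0 \<le> t / s" using assms by simp
  then have m: "real ?m \<le> t / s" "t / s < real ?m + 1" by linarith+
  have "t / s < real N" using assms by (simp add: divide_simps)
  then have "?m < N" using m by linarith
  moreover have "real ?m * s \<le> t" "t < real ?m * s + s"
    using m assms(1) by (simp_all add: field_simps)
  ultimately show ?thesis by blast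
qed

lemma Union_grid:
  fixes a :: "real ^ 'n"
  assumes "s > 0"
  shows "\<Union>(grid N a s) = cube a (real N * s)"
proof (intro equalityI subsetI)
  fix x assume "x \<in> \<Union>(grid N a s)"
  then obtain k where k: "\<And>i. k i < N"
    "\<And>i. a $ i + real (k i) * s \<le> x $ i \<and> x $ i < a $ i + real (k i) * s + s"
    by (auto simp: grid_def cube_def)
  show "x \<in> cube a (real N * s)"
    unfolding cube_def
  proof (intro CollectI allI conjI)
    fix i
    have "0 \<le> real (k i) * s" using assms by simp
    then show "a $ i \<le> x $ i" using k(2)[of i] by linarith
    have "(real (k i) + 1) * s \<le> real N * s"
      using k(1)[of i] assms by (intro mult_right_mono) auto
    then show "x $ i < a $ i + real N * s" using k(2)[of i] by (simp add: algebra_simps)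
  qed
next
  fix x assume "x \<in> cube a (real N * s)"
  then have "\<exists>m<N. real m * s \<le> x $ i - a $ i \<and> x $ i - a $ i < real m * s + s" for i
    by (intro floor_cell[OF assms]) (auto simp: cube_def algebra_simps)
  then obtain k where k: "\<And>i. k i < N \<and> real (k i) * s \<le> x $ i - a $ i
      \<and> x $ i - a $ i < real (k i) * s + s" by metis
  have "x \<in> cube (\<chi> i. a $ i + real (k i) * s) s"
    using k by (auto simp: cube_def algebra_simps)
  moreover have "k \<in> UNIV \<rightarrow>\<^sub>E {..<N}" using k by auto
  ultimately show "x \<in> \<Union>(grid N a s)" unfolding grid_def by blast
qed

lemma disjoint_grid:
  fixes a :: "real ^ 'n"
  assumes "s > 0"
  shows "disjoint (grid N a s)"
proof (rule disjointI)
  fix P Q assume "P \<in> grid N a s" "Q \<in> grid N a s" "P \<noteq> Q"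
  then obtain k m where P: "P = cube (\<chi> i. a $ i + real (k i) * s) s"
    and Q: "Q = cube (\<chi> i. a $ i + real (m i) * s) s" and "k \<noteq> m"
    by (auto simp: grid_def)
  then obtain i where "k i \<noteq> m i" by blast
  then have "real (k i) + 1 \<le> real (m i) \<or> real (m i) + 1 \<le> real (k i)" by linarith
  then have "(real (k i) + 1) * s \<le> real (m i) * s \<or> (real (m i) + 1) * s \<le> real (k i) * s"
    using assms mult_right_mono less_imp_le by metis
  then show "P \<inter> Q = {}"
    unfolding P Q cube_def by (auto simp: algebra_simps) (smt (verit))+
qed

lemma tiling_subset_grid:
  fixes a :: "real ^ 'n"
  assumes s: "s > 0" and C: "\<And>Q. Q \<in> C \<Longrightarrow> \<exists>c. Q = cube c s"
    and disj: "disjoint C" and un: "\<Union>C = cube a (real N * s)"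
  shows "C \<subseteq> grid N a s"
proof
  fix Q assume Q: "Q \<in> C"
  then obtain c where c: "Q = cube c s" using C by blast
  have "c \<in> cube a (real N * s)" using Q c un cube_nonempty[OF s] by blast
  have "\<exists>m<N. c $ i = a $ i + real m * s" for i
  proof -
    define pt where "pt t = (\<chi> k. if k = i then t else c $ k)" for t :: real
    have line: "pt t \<in> cube a (real N * s) \<longleftrightarrow> a $ i \<le> t \<and> t < a $ i + real N * s" for t
      unfolding pt_def by (rule cube_line[OF \<open>c \<in> cube a (real N * s)\<close>])
    have tile: "pt t \<in> cube b s \<longleftrightarrow> b $ i \<le> t \<and> t < b $ i + s" if "pt u \<in> cube b s" for b t u
    proof -
      have "pt t = (\<chi> k. if k = i then t else pt u $ k)" by (simp add: pt_def vec_eq_iff)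
      then show ?thesis using cube_line[OF that] by simp
    qed
    have same: "P = P'" if "P \<in> C" "P' \<in> C" "x \<in> P" "x \<in> P'" for P P' x
      using disj that unfolding disjoint_def by blast
    have start: "\<exists>b. cube b s \<in> C \<and> pt (a $ i + real m * s) \<in> cube b s \<and> b $ i = a $ i + real m * s"
      if "m < N" for m
      using that
    proof (induction m)
      case 0
      then have "pt (a $ i) \<in> \<Union>C" unfolding un line using s by simp
      then obtain b where b: "cube b s \<in> C" "pt (a $ i) \<in> cube b s" using C by blast
      have "b $ i \<le> a $ i" using tile[OF b(2)] b(2) by blast
      moreover have "pt (b $ i) \<in> cube b s" using tile[OF b(2)] s by simp
      then have "a $ i \<le> b $ i" using line b(1) un by blast
      ultimately show ?case using b by auto
    next
      case (Suc m)
      let ?t = "a $ i + real m * s"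
      let ?u = "a $ i + real (Suc m) * s"
      have u: "?u = ?t + s" by (simp add: algebra_simps)
      obtain b where b: "cube b s \<in> C" "pt ?t \<in> cube b s" "b $ i = ?t"
        using Suc by auto
      have "?u < a $ i + real N * s" using Suc.prems s by simp
      then have "pt ?u \<in> \<Union>C" unfolding un line using s by simp
      then obtain d where d: "cube d s \<in> C" "pt ?u \<in> cube d s" using C by blast
      have du: "d $ i \<le> ?u" "?u < d $ i + s" using tile[OF d(2)] d(2) by blast+
      have "\<not> d $ i < ?u"
      proof
        assume "d $ i < ?u"
        then have "pt (d $ i) \<in> cube b s" using tile[OF b(2)] b(3) du u by simp
        moreover have "pt (d $ i) \<in> cube d s" using tile[OF d(2)] s by simp
        ultimately have "cube d s = cube b s" using same b(1) d(1) by blast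
        then have "d = b" using cube_inject s by blast
        then show False using b(3) u du by simp
      qed
      then show ?case using d du by force
    qed
    have "pt (c $ i) = c" by (simp add: pt_def vec_eq_iff)
    then have ci: "pt (c $ i) \<in> cube c s" using cube_nonempty[OF s] by simp
    have "0 \<le> c $ i - a $ i" "c $ i - a $ i < real N * s"
      using \<open>c \<in> cube a (real N * s)\<close> by (auto simp: cube_def algebra_simps)
    from floor_cell[OF s this] obtain m where m: "m < N"
      "real m * s \<le> c $ i - a $ i" "c $ i - a $ i < real m * s + s" by blast
    obtain b where b: "cube b s \<in> C" "pt (a $ i + real m * s) \<in> cube b s" "b $ i = a $ i + real m * s"
      using start[OF m(1)] by blast
    have "pt (c $ i) \<in> cube b s" using tile[OF b(2)] b(3) m by simp
    then have "cube b s = cube c s" using same b(1) Q c ci by blast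
    then have "b = c" using cube_inject s by blast
    then show ?thesis using b(3) m(1) by blast
  qed
  then obtain k where k: "\<And>i. k i < N \<and> c $ i = a $ i + real (k i) * s" by metis
  have "c = (\<chi> i. a $ i + real (k i) * s)" using k by (simp add: vec_eq_iff)
  moreover have "k \<in> UNIV \<rightarrow>\<^sub>E {..<N}" using k by auto
  ultimately show "Q \<in> grid N a s" unfolding grid_def c by blast
qed

lemma is_dyadic_partition_iff:
  fixes a :: "real ^ 'n"
  assumes l: "l > 0"
  shows "is_dyadic_partition j (cube a l) C \<longleftrightarrow> C = grid (2 ^ j) a (l / 2 ^ j)"
proof -
  let ?s = "l / 2 ^ j"
  have s: "?s > 0" using l by simp
  show ?thesis
  proof
    assume "C = grid (2 ^ j) a ?s"
    then show "is_dyadic_partition j (cube a l) C"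
      unfolding is_dyadic_partition_def
      using s card_grid[OF s, of "2 ^ j" a] disjoint_grid[OF s] Union_grid[OF s, of "2 ^ j" a]
      by (auto simp: power_mult side_cube[OF l] side_cube[OF s] is_cube_def grid_def)
  next
    assume P: "is_dyadic_partition j (cube a l) C"
    have "\<exists>c. Q = cube c ?s" if "Q \<in> C" for Q
      using P that side_cube side_cube[OF l] unfolding is_dyadic_partition_def is_cube_def by metis
    moreover have "disjoint C" "\<Union>C = cube a (real (2 ^ j) * ?s)"
      using P by (simp_all add: is_dyadic_partition_def)
    ultimately have "C \<subseteq> grid (2 ^ j) a ?s" by (intro tiling_subset_grid[OF s])
    moreover have "card C = card (grid (2 ^ j) a ?s)"
      using P card_grid[OF s, of "2 ^ j" a] by (simp add: is_dyadic_partition_def power_mult)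
    moreover have "finite (grid (2 ^ j) a ?s)" by (simp add: grid_def finite_PiE)
    ultimately show "C = grid (2 ^ j) a ?s" by (metis card_subset_eq)
  qed
qed

lemma dyadic_gen_cube: "l > 0 \<Longrightarrow> dyadic_gen j (cube a l) = grid (2 ^ j) a (l / 2 ^ j)"
  unfolding dyadic_gen_def by (rule the_equality) (simp_all add: is_dyadic_partition_iff)

end

(* Let N_j(R) be the number of cubes of S in the j-th dyadic generation of R. Closure under parents
   makes N_j(R) / 2^(j d) nonincreasing in j, and the Carleson condition bounds its sum over j by xi.
   Hence N_m(R) is at most half of 2^(m d) for some m that does not depend on R, and iterating this
   inside the cubes of S gives N_j(R) <= 2^(j d) / 2^(j div m), which is the power sum estimate.
   For well-sparseness, each R in S contains within m generations a cube T outside S; taking T of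
   least generation makes it maximal outside S, so two such T are equal or disjoint, and the at most
   m cubes R sharing the same T are given different subcubes of T. *)
theory Submission imports Defs begin

section \<open>Volume and side length of half-open cubes\<close>

lemma cube_measurable: "cube a l \<in> sets borel"
proof -
  have "cube a l = (\<Inter>i. {x. a $ i \<le> x $ i} \<inter> {x. x $ i < a $ i + l})"
    by (auto simp: cube_def)
  moreover have "{x. a $ i \<le> x $ i} \<in> sets borel" "{x. x $ i < a $ i + l} \<in> sets borel" for i
    by (auto intro!: borel_closed borel_open closed_Collect_le open_Collect_less continuous_intros)
  ultimately show ?thesis
    by (auto intro!: sets.countable_INT')
qed

text \<open>The half-open cube lies between the open box and the closed box with the same corners,
  and these have equal measure.\<close>

lemma vol_cube:
  fixes a :: "real ^ 'n"
  assumes "l > 0"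
  shows "vol (cube a l) = l ^ CARD('n)"
proof -
  define b where "b = (\<chi> i. a $ i + l)"
  have sub: "box a b \<subseteq> cube a l" "cube a l \<subseteq> cbox a b"
    by (auto simp: cube_def b_def mem_box_cart) (meson less_imp_le)+
  have "measure lborel (cbox a b) = (\<Prod>i\<in>UNIV. b $ i - a $ i)"
    using assms by (intro content_cbox_cart) (simp add: b_def interval_ne_empty_cart less_imp_le)
  then have cb: "measure lebesgue (cbox a b) = l ^ CARD('n)"
    by (simp add: b_def)
  have "cube a l \<in> sets lebesgue"
    using cube_measurable[of a l] by (simp add: sets_completionI_sets)
  then have lm: "cube a l \<in> lmeasurable"
    using sub(2) by (meson bounded_cbox bounded_set_imp_lmeasurable bounded_subset)
  have "measure lebesgue (box a b) \<le> vol (cube a l)"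
    using sub lm by (intro measure_mono_fmeasurable) auto
  moreover have "vol (cube a l) \<le> measure lebesgue (cbox a b)"
    using sub lm by (intro measure_mono_fmeasurable) auto
  moreover have "measure lebesgue (box a b) = measure lebesgue (cbox a b)"
    by (simp add: measure_lborel_box_eq measure_lborel_cbox_eq)
  ultimately show ?thesis using cb by simp
qed

lemma side_pos: "is_cube Q \<Longrightarrow> side Q > 0"
  by (auto simp: is_cube_def side_cube)

lemma cube_not_empty: "is_cube Q \<Longrightarrow> Q \<noteq> {}"
  using cube_nonempty by (auto simp: is_cube_def)

lemma vol_is_cube:
  fixes Q :: "(real ^ 'n) set"
  shows "is_cube Q \<Longrightarrow> vol Q = side Q ^ CARD('n)"
  by (auto simp: is_cube_def side_cube vol_cube)

lemma vol_pos: "is_cube Q \<Longrightarrow> vol Q > 0"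
  by (simp add: vol_is_cube side_pos)

section \<open>Dyadic generations below a single cube\<close>

lemma dyadic_gen_partition: "is_cube R \<Longrightarrow> is_dyadic_partition j R (dyadic_gen j R)"
  by (auto simp: is_cube_def is_dyadic_partition_iff dyadic_gen_cube)

lemma dyadic_genD:
  assumes "is_cube R" "Q \<in> dyadic_gen j R"
  shows dyadic_gen_is_cube: "is_cube Q"
    and dyadic_gen_side: "side Q = side R / 2 ^ j"
    and dyadic_gen_subset: "Q \<subseteq> R"
  using dyadic_gen_partition[OF assms(1), of j] assms(2) by (auto simp: is_dyadic_partition_def)

lemma dyadic_gen_card:
  fixes R :: "(real ^ 'n) set"
  shows "is_cube R \<Longrightarrow> card (dyadic_gen j R) = 2 ^ (j * CARD('n))"
  using dyadic_gen_partition[of R j] by (simp add: is_dyadic_partition_def)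

lemma dyadic_gen_finite: "is_cube R \<Longrightarrow> finite (dyadic_gen j R)"
  using dyadic_gen_card[of R j] by (simp add: card_ge_0_finite)

lemma dyadic_gen_Union: "is_cube R \<Longrightarrow> \<Union>(dyadic_gen j R) = R"
  using dyadic_gen_partition[of R j] by (simp add: is_dyadic_partition_def)

lemma dyadic_gen_eq:
  "is_cube R \<Longrightarrow> P \<in> dyadic_gen j R \<Longrightarrow> Q \<in> dyadic_gen j R \<Longrightarrow> P \<inter> Q \<noteq> {} \<Longrightarrow> P = Q"
  using dyadic_gen_partition[of R j] by (auto simp: is_dyadic_partition_def disjoint_def)

lemma dyadic_gen_0:
  assumes "is_cube R"
  shows "dyadic_gen 0 R = {R}"
proof -
  obtain P where P: "dyadic_gen 0 R = {P}"
    using dyadic_gen_card[OF assms, of 0] by (auto simp: card_1_singleton_iff)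
  then show ?thesis using dyadic_gen_Union[OF assms, of 0] by simp
qed

lemma dyadic_gen_vol:
  fixes R :: "(real ^ 'n) set"
  assumes "is_cube R" "Q \<in> dyadic_gen j R"
  shows "vol Q = vol R / 2 ^ (j * CARD('n))"
  using dyadic_gen_is_cube[OF assms] dyadic_gen_side[OF assms] assms(1)
  by (simp add: vol_is_cube power_divide power_mult)

text \<open>Halving a positive side length never repeats a value, so the side of \<open>Q\<close>
  determines its generation. Hence different generations share no cube.\<close>

lemma dyadic_gen_index:
  assumes "is_cube R" "Q \<in> dyadic_gen i R" "Q \<in> dyadic_gen j R"
  shows "i = j"
proof -
  have "side R / 2 ^ i = side R / 2 ^ j"
    using dyadic_gen_side[OF assms(1,2)] dyadic_gen_side[OF assms(1,3)] by (rule subst)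
  then show ?thesis using side_pos[OF assms(1)] by (auto simp: frac_eq_eq)
qed

text \<open>Every grid cell meets some tile; that tile is itself a grid cell, and disjointness of
  the grid makes the two equal. No count of the tiles is needed, which suits tilings assembled from
  smaller ones.\<close>

lemma tiling_eq_grid:
  fixes a :: "real ^ 'n"
  assumes s: "s > 0" and C: "\<And>Q. Q \<in> C \<Longrightarrow> \<exists>c. Q = cube c s"
    and disj: "disjoint C" and un: "\<Union>C = cube a (real N * s)"
  shows "C = grid N a s"
proof
  show sub: "C \<subseteq> grid N a s" by (rule tiling_subset_grid[OF assms])
  show "grid N a s \<subseteq> C"
  proof
    fix Q assume Q: "Q \<in> grid N a s"
    then obtain x where x: "x \<in> Q" using cube_nonempty[OF s] by (force simp: grid_def)
    then have "x \<in> \<Union>C" using Q un Union_grid[OF s, of N a] by blast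
    then obtain P where P: "P \<in> C" "x \<in> P" by blast
    then have "P = Q" using disjoint_grid[OF s, of N a] sub Q x by (auto simp: disjoint_def)
    then show "Q \<in> C" using P by simp
  qed
qed

text \<open>Refining each cube of generation \<open>j\<close> by \<open>k\<close> further
  generations gives disjoint cubes of the right side length that cover \<open>R\<close>, and the
  tiling of \<open>R\<close> by cubes of that side is unique.\<close>

lemma dyadic_gen_add:
  assumes R: "is_cube R"
  shows "dyadic_gen (j + k) R = (\<Union>P\<in>dyadic_gen j R. dyadic_gen k P)"
proof -
  obtain a l where l: "l > 0" "R = cube a l" using R by (auto simp: is_cube_def)
  let ?C = "\<Union>P\<in>dyadic_gen j R. dyadic_gen k P" and ?s = "l / 2 ^ (j + k)"
  have s: "?s > 0" using l by simp
  have "?C = grid (2 ^ (j + k)) a ?s"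
  proof (rule tiling_eq_grid[OF s])
    fix Q assume "Q \<in> ?C"
    then obtain P where P: "P \<in> dyadic_gen j R" "Q \<in> dyadic_gen k P" by blast
    have c: "is_cube P" by (rule dyadic_gen_is_cube[OF R P(1)])
    have "side Q = ?s"
      using dyadic_gen_side[OF c P(2)] dyadic_gen_side[OF R P(1)] l
      by (simp add: side_cube power_add)
    then show "\<exists>c. Q = cube c ?s"
      using dyadic_gen_is_cube[OF c P(2)] by (auto simp: is_cube_def side_cube)
  next
    show "disjoint ?C"
    proof (rule disjointI, rule ccontr)
      fix Q Q' assume "Q \<in> ?C" "Q' \<in> ?C" and ne: "Q \<noteq> Q'" "Q \<inter> Q' \<noteq> {}"
      then obtain P P' where P: "P \<in> dyadic_gen j R" "Q \<in> dyadic_gen k P"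
        "P' \<in> dyadic_gen j R" "Q' \<in> dyadic_gen k P'" by blast
      have c: "is_cube P" "is_cube P'" using dyadic_gen_is_cube[OF R] P by auto
      have "P \<inter> P' \<noteq> {}"
        using dyadic_gen_subset[OF c(1) P(2)] dyadic_gen_subset[OF c(2) P(4)] ne by blast
      then have "P = P'" using dyadic_gen_eq[OF R P(1) P(3)] by simp
      then show False using dyadic_gen_eq[OF c(1) P(2)] P(4) ne by blast
    qed
    have "\<Union>?C = (\<Union>P\<in>dyadic_gen j R. \<Union>(dyadic_gen k P))" by blast
    also have "\<dots> = (\<Union>P\<in>dyadic_gen j R. P)"
      by (intro SUP_cong refl dyadic_gen_Union dyadic_gen_is_cube[OF R])
    finally show "\<Union>?C = cube a (real (2 ^ (j + k)) * ?s)"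
      using dyadic_gen_Union[OF R] l by simp
  qed
  then show ?thesis using dyadic_gen_cube[OF l(1)] l(2) by simp
qed

section \<open>Nesting and ancestors in a dyadic lattice\<close>

lemma dyadic_lattice_cube: "dyadic_lattice D \<Longrightarrow> Q \<in> D \<Longrightarrow> is_cube Q"
  by (simp add: dyadic_lattice_def)

lemma dyadic_lattice_gen: "dyadic_lattice D \<Longrightarrow> R \<in> D \<Longrightarrow> Q \<in> dyadic_gen j R \<Longrightarrow> Q \<in> D"
  unfolding dyadic_lattice_def dyadic_cubes_def by blast

lemma dyadic_lattice_ancestor:
  assumes "dyadic_lattice D" "P \<in> D" "Q \<in> D"
  obtains R i j where "R \<in> D" "P \<in> dyadic_gen i R" "Q \<in> dyadic_gen j R"
proof -
  have "\<forall>P\<in>D. \<forall>Q\<in>D. \<exists>R\<in>D. P \<in> dyadic_cubes R \<and> Q \<in> dyadic_cubes R"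
    using assms(1) unfolding dyadic_lattice_def by (elim conjE)
  then obtain R where "R \<in> D" "P \<in> dyadic_cubes R" "Q \<in> dyadic_cubes R"
    using assms(2,3) by metis
  then show thesis using that unfolding dyadic_cubes_def by blast
qed

text \<open>\<open>Q\<close> descends from some cube of generation \<open>i\<close>; this cube meets
  \<open>P\<close>, so it is \<open>P\<close>.\<close>

lemma dyadic_gen_nested:
  assumes R: "is_cube R" and P: "P \<in> dyadic_gen i R" and Q: "Q \<in> dyadic_gen j R"
    and "P \<inter> Q \<noteq> {}" "i \<le> j"
  shows "Q \<in> dyadic_gen (j - i) P"
proof -
  have "Q \<in> dyadic_gen (i + (j - i)) R" using Q assms(5) by simp
  then obtain P' where P': "P' \<in> dyadic_gen i R" "Q \<in> dyadic_gen (j - i) P'"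
    unfolding dyadic_gen_add[OF R] by blast
  have "Q \<subseteq> P'" using dyadic_gen_subset dyadic_gen_is_cube[OF R P'(1)] P'(2) by blast
  then have "P' = P" using dyadic_gen_eq[OF R P'(1) P] assms(4) by blast
  then show ?thesis using P' by simp
qed

lemma dyadic_lattice_nested:
  assumes "dyadic_lattice D" "P \<in> D" "Q \<in> D" "P \<inter> Q \<noteq> {}"
  shows "(\<exists>j. Q \<in> dyadic_gen j P) \<or> (\<exists>j. P \<in> dyadic_gen j Q)"
proof -
  obtain R i j where R: "R \<in> D" "P \<in> dyadic_gen i R" "Q \<in> dyadic_gen j R"
    using dyadic_lattice_ancestor[OF assms(1-3)] .
  have c: "is_cube R" by (rule dyadic_lattice_cube[OF assms(1) R(1)])
  show ?thesis
    using dyadic_gen_nested[OF c R(2,3)] dyadic_gen_nested[OF c R(3,2)] assms(4)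
    by (metis inf_commute nat_le_linear)
qed

text \<open>Turns inclusion of lattice cubes into the generation relation, so that a sum over
  \<open>Q \<subseteq> R\<close> can be arranged by generations of \<open>R\<close>.\<close>

lemma dyadic_lattice_subset:
  assumes "dyadic_lattice D" "R \<in> D" "Q \<in> D" "Q \<subseteq> R"
  shows "\<exists>j. Q \<in> dyadic_gen j R"
proof -
  have c: "is_cube Q" "is_cube R" using dyadic_lattice_cube assms by auto
  have "R \<inter> Q \<noteq> {}" using cube_not_empty[OF c(1)] assms(4) by blast
  from dyadic_lattice_nested[OF assms(1-3) this] show ?thesis
  proof
    assume "\<exists>j. R \<in> dyadic_gen j Q"
    then have "R = Q" using dyadic_gen_subset[OF c(1)] assms(4) by blast
    then have "Q \<in> dyadic_gen 0 R" using dyadic_gen_0[OF c(1)] by simp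
    then show ?thesis by blast
  qed
qed

text \<open>Inside a common ancestor of \<open>P\<close> and \<open>P'\<close> the generation of
  \<open>Q\<close> is unique, so \<open>P\<close> and \<open>P'\<close> have the same generation
  there; both contain the nonempty \<open>Q\<close>, so they coincide.\<close>

lemma dyadic_lattice_ancestor_unique:
  assumes "dyadic_lattice D" "P \<in> D" "P' \<in> D" "Q \<in> dyadic_gen k P" "Q \<in> dyadic_gen k P'"
  shows "P = P'"
proof -
  obtain R i j where R: "R \<in> D" "P \<in> dyadic_gen i R" "P' \<in> dyadic_gen j R"
    using dyadic_lattice_ancestor[OF assms(1-3)] .
  have c: "is_cube R" "is_cube P" "is_cube P'" using dyadic_lattice_cube assms R by auto
  have "Q \<in> dyadic_gen (i + k) R" "Q \<in> dyadic_gen (j + k) R"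
    using R assms(4,5) unfolding dyadic_gen_add[OF c(1)] by auto
  then have ij: "i = j" using dyadic_gen_index[OF c(1)] by force
  have "Q \<noteq> {}" using cube_not_empty dyadic_gen_is_cube[OF c(2) assms(4)] by blast
  then have "P \<inter> P' \<noteq> {}"
    using dyadic_gen_subset[OF c(2) assms(4)] dyadic_gen_subset[OF c(3) assms(5)] by blast
  then show ?thesis using dyadic_gen_eq[OF c(1)] R ij by blast
qed

lemma parent_eq:
  assumes "dyadic_lattice D" "P \<in> D" "Q \<in> dyadic_gen 1 P"
  shows "parent D Q = P"
  unfolding parent_def
  by (rule the_equality) (use assms dyadic_lattice_ancestor_unique in blast)+

text \<open>Climb from \<open>Q\<close> to \<open>R\<close> one parent at a time; every cube on the
  way stays in \<open>S\<close>.\<close>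

lemma parent_closed_ancestor:
  assumes D: "dyadic_lattice D" and par: "\<forall>Q\<in>S. parent D Q \<in> S"
    and "R \<in> D" "Q \<in> S" "Q \<in> dyadic_gen j R"
  shows "R \<in> S"
  using assms(4,5)
proof (induction j arbitrary: Q)
  case 0
  have c: "is_cube R" using D assms(3) by (rule dyadic_lattice_cube)
  then show ?case using 0 dyadic_gen_0[OF c] by simp
next
  case (Suc j)
  have c: "is_cube R" using D assms(3) by (rule dyadic_lattice_cube)
  have "Q \<in> dyadic_gen (j + 1) R" using Suc.prems by simp
  then obtain P where P: "P \<in> dyadic_gen j R" "Q \<in> dyadic_gen 1 P"
    unfolding dyadic_gen_add[OF c] by blast
  have "P \<in> S"
    using parent_eq[OF D dyadic_lattice_gen[OF D assms(3) P(1)] P(2)] par Suc.prems(1) by auto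
  then show ?case using Suc.IH P(1) by blast
qed

section \<open>Counting the cubes of \<open>S\<close> in each generation\<close>

text \<open>A cube of \<open>S\<close> in generation \<open>j + k\<close> has its ancestor of
  generation \<open>j\<close> in \<open>S\<close>, so only the cubes counted in generation
  \<open>j\<close> contribute, each at most \<open>b\<close>.\<close>

lemma card_gen_add:
  assumes D: "dyadic_lattice D" and SD: "S \<subseteq> D" and par: "\<forall>Q\<in>S. parent D Q \<in> S"
    and R: "R \<in> D" and b: "\<And>P. P \<in> S \<Longrightarrow> card (S \<inter> dyadic_gen k P) \<le> b"
  shows "card (S \<inter> dyadic_gen (j + k) R) \<le> card (S \<inter> dyadic_gen j R) * b"
proof -
  have c: "is_cube R" using D R by (rule dyadic_lattice_cube)
  have fin: "finite (S \<inter> dyadic_gen j R)" using dyadic_gen_finite[OF c] by simp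
  have "S \<inter> dyadic_gen (j + k) R \<subseteq> (\<Union>P\<in>S \<inter> dyadic_gen j R. S \<inter> dyadic_gen k P)"
    using parent_closed_ancestor[OF D par dyadic_lattice_gen[OF D R]]
    unfolding dyadic_gen_add[OF c] by blast
  moreover have "finite (\<Union>P\<in>S \<inter> dyadic_gen j R. S \<inter> dyadic_gen k P)"
    using dyadic_gen_finite[OF dyadic_gen_is_cube[OF c]] by (intro finite_UN_I[OF fin]) blast
  ultimately have "card (S \<inter> dyadic_gen (j + k) R)
      \<le> card (\<Union>P\<in>S \<inter> dyadic_gen j R. S \<inter> dyadic_gen k P)"
    by (rule card_mono[rotated])
  also have "\<dots> \<le> (\<Sum>P\<in>S \<inter> dyadic_gen j R. card (S \<inter> dyadic_gen k P))"
    by (rule card_UN_le[OF fin])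
  also have "\<dots> \<le> card (S \<inter> dyadic_gen j R) * b"
    using b sum_bounded_above[of "S \<inter> dyadic_gen j R" "\<lambda>P. card (S \<inter> dyadic_gen k P)" b] by auto
  finally show ?thesis .
qed

lemma card_gen_le:
  fixes R :: "(real ^ 'n) set"
  assumes "is_cube R"
  shows "card (S \<inter> dyadic_gen j R) \<le> 2 ^ (j * CARD('n))"
  using card_mono[OF dyadic_gen_finite[OF assms], of "S \<inter> dyadic_gen j R" j]
  by (simp add: dyadic_gen_card[OF assms])

text \<open>Generations are disjoint and volume is constant on each. The function \<open>f\<close>
  is the identity for the Carleson sum and a power for the final estimate.\<close>

lemma sum_gen:
  fixes R :: "(real ^ 'n) set" and f :: "real \<Rightarrow> real"
  assumes c: "is_cube R" and "finite J"
  shows "(\<Sum>Q\<in>(\<Union>j\<in>J. S \<inter> dyadic_gen j R). f (vol Q))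
    = (\<Sum>j\<in>J. card (S \<inter> dyadic_gen j R) * f (vol R / 2 ^ (j * CARD('n))))"
proof -
  have "(\<Sum>Q\<in>(\<Union>j\<in>J. S \<inter> dyadic_gen j R). f (vol Q))
      = (\<Sum>j\<in>J. \<Sum>Q\<in>S \<inter> dyadic_gen j R. f (vol Q))"
    using assms dyadic_gen_finite[OF c] dyadic_gen_index[OF c]
    by (intro sum.UNION_disjoint) auto
  also have "\<dots> = (\<Sum>j\<in>J. \<Sum>Q\<in>S \<inter> dyadic_gen j R. f (vol R / 2 ^ (j * CARD('n))))"
    using dyadic_gen_vol[OF c] by (intro sum.cong) auto
  finally show ?thesis by simp
qed

lemma Carleson_density_half:
  fixes D S :: "(real ^ 'n) set set"
  assumes D: "dyadic_lattice D" and SD: "S \<subseteq> D" and par: "\<forall>Q\<in>S. parent D Q \<in> S"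
    and "Carleson D S"
  obtains m where "m > 0"
    "\<And>R. R \<in> D \<Longrightarrow> 2 * card (S \<inter> dyadic_gen m R) \<le> 2 ^ (m * CARD('n))"
proof -
  let ?d = "CARD('n)"
  obtain \<xi> :: real where xi: "\<xi> > 0" and
    carl: "\<And>R. R \<in> D \<Longrightarrow> (\<Sum>\<^sub>\<infinity>Q\<in>{Q \<in> S. Q \<subseteq> R}. ennreal (vol Q)) \<le> ennreal (\<xi> * vol R)"
    using assms(4) unfolding Carleson_def by blast
  \<comment> \<open>With \<open>n\<close> and \<open>?d\<close> as below, the densities
    \<open>n j / 2 ^ (j * ?d)\<close> for \<open>j < m\<close> sum to at most \<xi>, and each is at
    least the density of generation \<open>m\<close>. Thus \<open>m\<close> times the latter is at
    most \<xi>, which is less than \<open>m / 2\<close>.\<close>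
  obtain m :: nat where m: "real m > 2 * \<xi>" using reals_Archimedean2 by blast
  have "2 * card (S \<inter> dyadic_gen m R) \<le> 2 ^ (m * ?d)" if R: "R \<in> D" for R
  proof -
    have c: "is_cube R" using D R by (rule dyadic_lattice_cube)
    \<comment> \<open>Finitely many generations suffice, and they turn the \<open>ennreal\<close>
      bound into one on a finite real sum.\<close>
    define F where "F = (\<Union>j\<in>{..<m}. S \<inter> dyadic_gen j R)"
    define n where "n j = card (S \<inter> dyadic_gen j R)" for j
    have F: "finite F" "F \<subseteq> {Q \<in> S. Q \<subseteq> R}"
      using dyadic_gen_finite[OF c] dyadic_gen_subset[OF c] by (auto simp: F_def)
    have "ennreal (\<Sum>Q\<in>F. vol Q) = (\<Sum>Q\<in>F. ennreal (vol Q))"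
      by (simp add: sum_ennreal)
    also have "\<dots> = (\<Sum>\<^sub>\<infinity>Q\<in>F. ennreal (vol Q))" using F by simp
    also have "\<dots> \<le> (\<Sum>\<^sub>\<infinity>Q\<in>{Q \<in> S. Q \<subseteq> R}. ennreal (vol Q))"
      using F by (intro infsum_mono_neutral) (auto intro: nonneg_summable_on_complete)
    finally have "ennreal (\<Sum>Q\<in>F. vol Q) \<le> ennreal (\<xi> * vol R)" using carl[OF R] by simp
    then have "(\<Sum>Q\<in>F. vol Q) \<le> \<xi> * vol R"
      using xi by (simp add: ennreal_le_iff)
    moreover have "(\<Sum>Q\<in>F. vol Q) = (\<Sum>j<m. n j * (vol R / 2 ^ (j * ?d)))"
      unfolding F_def n_def using sum_gen[OF c, of "{..<m}" "\<lambda>v. v" S] by simp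
    \<comment> \<open>The volume occupied by \<open>S\<close> does not grow from generation
      \<open>j\<close> to \<open>m\<close>: descendants in \<open>S\<close> come only from cubes in
      \<open>S\<close>.\<close>
    moreover have "n m * (vol R / 2 ^ (m * ?d)) \<le> n j * (vol R / 2 ^ (j * ?d))" if "j < m" for j
    proof -
      have "n (j + (m - j)) \<le> n j * 2 ^ ((m - j) * ?d)"
        unfolding n_def using SD dyadic_lattice_cube[OF D]
        by (intro card_gen_add[OF D SD par R] card_gen_le) auto
      then have "n m \<le> n j * 2 ^ ((m - j) * ?d)" using that by simp
      then have "real (n m) \<le> real (n j) * 2 ^ ((m - j) * ?d)"
        by (metis of_nat_le_iff of_nat_mult of_nat_numeral of_nat_power)
      then have "n m * (vol R / 2 ^ (m * ?d))
          \<le> n j * 2 ^ ((m - j) * ?d) * (vol R / 2 ^ (m * ?d))"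
        by (intro mult_right_mono) auto
      also have "\<dots> = n j * (vol R / 2 ^ (j * ?d))"
      proof -
        have "(2::real) ^ (m * ?d) = 2 ^ ((m - j) * ?d) * 2 ^ (j * ?d)"
          using that by (simp flip: power_add add_mult_distrib)
        then show ?thesis by simp
      qed
      finally show ?thesis .
    qed
    then have "(\<Sum>j<m. n m * (vol R / 2 ^ (m * ?d))) \<le> (\<Sum>j<m. n j * (vol R / 2 ^ (j * ?d)))"
      by (intro sum_mono) auto
    ultimately have "m * (n m * (vol R / 2 ^ (m * ?d))) \<le> \<xi> * vol R" by simp
    then have "m * (n m / 2 ^ (m * ?d)) * vol R \<le> \<xi> * vol R" by (simp add: field_simps)
    then have "m * (n m / 2 ^ (m * ?d)) \<le> \<xi>"
      by (rule mult_right_le_imp_le) (rule vol_pos[OF c])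
    also have "\<xi> \<le> m * (1 / 2)" using m by simp
    finally have "n m / 2 ^ (m * ?d) \<le> 1 / 2"
      by (rule mult_left_le_imp_le) (use m xi in linarith)
    then have "real (2 * n m) \<le> real (2 ^ (m * ?d))" by (simp add: field_simps)
    then show ?thesis unfolding n_def by (simp only: of_nat_le_iff)
  qed
  moreover have "m > 0" using m xi by (cases m) auto
  ultimately show ?thesis using that by blast
qed

text \<open>Each further block of \<open>m\<close> generations multiplies the count by at most half
  of \<open>2 ^ (m * CARD('n))\<close>. The free offset \<open>r\<close> lets the bound reach every
  generation, through division by \<open>m\<close> with remainder.\<close>

lemma card_gen_decay:
  fixes D S :: "(real ^ 'n) set set"
  assumes D: "dyadic_lattice D" and SD: "S \<subseteq> D" and par: "\<forall>Q\<in>S. parent D Q \<in> S"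
    and half: "\<And>R. R \<in> D \<Longrightarrow> 2 * card (S \<inter> dyadic_gen m R) \<le> 2 ^ (m * CARD('n))"
    and R: "R \<in> D"
  shows "2 ^ q * card (S \<inter> dyadic_gen (r + q * m) R) \<le> 2 ^ ((r + q * m) * CARD('n))"
proof (induction q)
  case 0
  show ?case using card_gen_le[OF dyadic_lattice_cube[OF D R]] by simp
next
  case (Suc q)
  let ?d = "CARD('n)" and ?n = "\<lambda>j. card (S \<inter> dyadic_gen j R)"
  have "2 * ?n (r + q * m + m) \<le> 2 * (?n (r + q * m) * (2 ^ (m * ?d) div 2))"
    using half SD by (intro mult_left_mono card_gen_add[OF D SD par R]) force+
  also have "\<dots> \<le> ?n (r + q * m) * 2 ^ (m * ?d)" by simp
  finally have "2 ^ q * (2 * ?n (r + q * m + m)) \<le> 2 ^ q * (?n (r + q * m) * 2 ^ (m * ?d))"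
    by (rule mult_left_mono) simp
  also have "\<dots> = 2 ^ q * ?n (r + q * m) * 2 ^ (m * ?d)"
    by simp
  also have "\<dots> \<le> 2 ^ ((r + q * m) * ?d) * 2 ^ (m * ?d)"
    by (intro mult_right_mono Suc.IH) simp
  also have "\<dots> = 2 ^ ((r + Suc q * m) * ?d)"
    by (simp flip: power_add add: algebra_simps)
  finally show ?case by (simp add: algebra_simps)
qed

section \<open>The power sum estimate\<close>

lemma power_sum_bound:
  fixes D S :: "(real ^ 'n) set set"
  assumes D: "dyadic_lattice D" and SD: "S \<subseteq> D" and par: "\<forall>Q\<in>S. parent D Q \<in> S"
    and half: "\<And>R. R \<in> D \<Longrightarrow> 2 * card (S \<inter> dyadic_gen m R) \<le> 2 ^ (m * CARD('n))"
    and m: "m > 0"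
  shows "\<exists>(\<alpha>::real) (\<zeta>::real). \<alpha> > 0 \<and> \<zeta> > 0 \<and>
      (\<forall>R\<in>D. (\<Sum>\<^sub>\<infinity>Q\<in>{Q \<in> S. Q \<subseteq> R}. ennreal (vol Q powr (1 - \<alpha> / real CARD('n))))
              \<le> ennreal (\<zeta> * vol R powr (1 - \<alpha> / real CARD('n))))"
proof (intro exI conjI ballI)
  let ?d = "CARD('n)"
  \<comment> \<open>In generation \<open>j\<close> the count decays like
    \<open>2 powr (- j / m)\<close>, which is \<open>2 powr (- 2 * j * \<alpha>)\<close>, while
    lowering the exponent of the volume costs \<open>2 powr (j * \<alpha>)\<close>. This choice
    leaves the geometric factor \<open>x ^ j\<close>.\<close>
  define \<alpha> :: real where "\<alpha> = 1 / (2 * m)"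
  define x :: real where "x = 2 powr - \<alpha>"
  define \<beta> where "\<beta> = 1 - \<alpha> / ?d"
  show a: "\<alpha> > 0" using m by (simp add: \<alpha>_def)
  have x: "0 < x" "x < 1" using a by (simp_all add: x_def powr_less_one)
  \<comment> \<open>This \<zeta> is the sum of the geometric series with terms
    \<open>2 * x ^ j\<close>.\<close>
  show "2 / (1 - x) > 0" using x by simp
  fix R assume R: "R \<in> D"
  have c: "is_cube R" using D R by (rule dyadic_lattice_cube)
  have v: "vol R > 0" using c by (rule vol_pos)
  have gen_term: "card (S \<inter> dyadic_gen j R) * (vol R / 2 ^ (j * ?d)) powr \<beta>
      \<le> 2 * x ^ j * vol R powr \<beta>" for j
  proof -
    let ?n = "card (S \<inter> dyadic_gen j R)"
    have "2 ^ (j div m) * ?n \<le> 2 ^ (j * ?d)"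
      using card_gen_decay[OF D SD par half R, where r = "j mod m" and q = "j div m"] by simp
    then have "real (2 ^ (j div m) * ?n) \<le> real (2 ^ (j * ?d))" by (simp only: of_nat_le_iff)
    then have "2 ^ (j div m) * real ?n \<le> 2 ^ (j * ?d)"
      by (simp only: of_nat_mult of_nat_power of_nat_numeral)
    then have n: "?n \<le> 2 powr (j * ?d) / 2 powr (j div m)"
      using powr_realpow[of 2 "j * ?d"] powr_realpow[of 2 "j div m"]
      by (simp add: pos_le_divide_eq mult.commute)
    \<comment> \<open>Rounding \<open>j / m\<close> down loses less than 1 in the exponent; this is
      the source of the factor 2 in \<open>gen_term\<close>.\<close>
    have jm: "real j / m - 1 \<le> real (j div m)"
      using floor_divide_of_nat_eq[where 'a = real, of j m] by linarith
    have "(vol R / 2 ^ (j * ?d)) powr \<beta> = vol R powr \<beta> / (2 powr (j * ?d)) powr \<beta>"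
      using v by (simp add: powr_divide powr_realpow flip: of_nat_mult)
    also have "(2 powr (j * ?d)) powr \<beta> = 2 powr (j * ?d - j * \<alpha>)"
      by (simp add: powr_powr \<beta>_def right_diff_distrib)
    finally have "?n * (vol R / 2 ^ (j * ?d)) powr \<beta>
        \<le> (2 powr (j * ?d) / 2 powr (j div m)) * (vol R powr \<beta> / 2 powr (j * ?d - j * \<alpha>))"
      using n by (simp only:) (intro mult_right_mono, auto)
    also have "\<dots> = 2 powr (j * \<alpha> - j div m) * vol R powr \<beta>"
      by (simp add: powr_diff)
    also have "\<dots> \<le> 2 powr (1 - j * \<alpha>) * vol R powr \<beta>"
    proof (intro mult_right_mono powr_mono)
      have "real j / m = 2 * (j * \<alpha>)" using m by (simp add: \<alpha>_def)
      then show "j * \<alpha> - j div m \<le> 1 - j * \<alpha>" using jm by linarith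
    qed auto
    also have "2 powr (1 - j * \<alpha>) = 2 * x ^ j"
      by (simp add: x_def powr_diff powr_minus powr_power mult.commute divide_inverse power_inverse)
    finally show ?thesis .
  qed
  \<comment> \<open>A bound uniform over finite subfamilies passes to the infinite sum of
    nonnegative terms.\<close>
  have fin_le: "(\<Sum>Q\<in>F. ennreal (vol Q powr \<beta>)) \<le> ennreal (2 / (1 - x) * vol R powr \<beta>)"
    if F: "finite F" "F \<subseteq> {Q \<in> S. Q \<subseteq> R}" for F
  proof -
    have "\<exists>j. Q \<in> dyadic_gen j R" if "Q \<in> F" for Q
      using dyadic_lattice_subset[OF D R] that F SD by blast
    then obtain g where g: "\<And>Q. Q \<in> F \<Longrightarrow> Q \<in> dyadic_gen (g Q) R" by metis
    \<comment> \<open>Enlarge \<open>F\<close> to all cubes of \<open>S\<close> in the finitely many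
      generations it meets, so that \<open>gen_term\<close> applies generation by
      generation.\<close>
    let ?G = "\<Union>j\<in>g ` F. S \<inter> dyadic_gen j R"
    have fin: "finite (g ` F)" using F by simp
    have "(\<Sum>Q\<in>F. vol Q powr \<beta>) \<le> (\<Sum>Q\<in>?G. vol Q powr \<beta>)"
      using F g dyadic_gen_finite[OF c] by (intro sum_mono2) auto
    also have "\<dots> = (\<Sum>j\<in>g ` F. card (S \<inter> dyadic_gen j R) * (vol R / 2 ^ (j * ?d)) powr \<beta>)"
      using sum_gen[OF c fin, of "\<lambda>v. v powr \<beta>" S] .
    also have "\<dots> \<le> (\<Sum>j\<in>g ` F. 2 * x ^ j * vol R powr \<beta>)"
      by (intro sum_mono gen_term)
    also have "\<dots> = 2 * vol R powr \<beta> * (\<Sum>j\<in>g ` F. x ^ j)"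
      unfolding sum_distrib_left by (intro sum.cong) (simp_all add: mult_ac)
    also have "\<dots> \<le> 2 * vol R powr \<beta> * (1 / (1 - x))"
    proof (intro mult_left_mono)
      have "(\<Sum>j\<in>g ` F. x ^ j) \<le> (\<Sum>j. x ^ j)"
        using x fin by (intro sum_le_suminf) auto
      then show "(\<Sum>j\<in>g ` F. x ^ j) \<le> 1 / (1 - x)" using x by (simp add: suminf_geometric)
    qed simp
    finally have "(\<Sum>Q\<in>F. vol Q powr \<beta>) \<le> 2 / (1 - x) * vol R powr \<beta>" by simp
    then show ?thesis by (subst sum_ennreal) (auto intro: ennreal_leI)
  qed
  show "(\<Sum>\<^sub>\<infinity>Q\<in>{Q \<in> S. Q \<subseteq> R}. ennreal (vol Q powr (1 - \<alpha> / ?d)))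
      \<le> ennreal (2 / (1 - x) * vol R powr (1 - \<alpha> / ?d))"
    unfolding \<beta>_def[symmetric]
    by (rule infsum_le_finite_sums[OF nonneg_summable_on_complete fin_le]) simp_all
qed

section \<open>Disjoint subcubes for well-sparseness\<close>

text \<open>A cube \<open>R\<close> of \<open>S\<close> is determined by the missing cube
  \<open>T R\<close> below it and the number \<open>i R\<close> of generations between them.
  Numbering subcubes of \<open>T R\<close> by that index therefore separates the cubes that share
  it.\<close>

lemma well_sparse_of_gaps:
  fixes D S :: "(real ^ 'n) set set"
  assumes D: "dyadic_lattice D" and SD: "S \<subseteq> D" and par: "\<forall>Q\<in>S. parent D Q \<in> S"
    and gap: "\<And>R. R \<in> D \<Longrightarrow> \<not> dyadic_gen m R \<subseteq> S" and m: "m > 0"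
  shows "well_sparse S"
proof -
  let ?d = "CARD('n)"
  have cube: "is_cube R" if "R \<in> D" for R using D that by (rule dyadic_lattice_cube)
  define i where "i R = (LEAST j. \<not> dyadic_gen j R \<subseteq> S)" for R
  have i_le: "i R \<le> m" if "R \<in> D" for R
    using gap[OF that] unfolding i_def by (rule Least_le)
  have "\<exists>T. T \<in> dyadic_gen (i R) R \<and> T \<notin> S" if "R \<in> D" for R
    using LeastI[of "\<lambda>j. \<not> dyadic_gen j R \<subseteq> S", OF gap[OF that]] unfolding i_def by blast
  then obtain T where T: "\<And>R. R \<in> D \<Longrightarrow> T R \<in> dyadic_gen (i R) R \<and> T R \<notin> S" by metis
  have TD: "T R \<in> D" if "R \<in> D" for R using dyadic_lattice_gen[OF D that] T[OF that] by blast
  \<comment> \<open>A lattice cube \<open>P\<close> outside \<open>S\<close> with \<open>T R\<close>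
    among its descendants is \<open>T R\<close> itself. Otherwise the parent of \<open>T R\<close>
    lies below \<open>P\<close>; it also lies in a generation of \<open>R\<close> before
    \<open>i R\<close>, hence in \<open>S\<close> by minimality, which forces \<open>P\<close> into
    \<open>S\<close>.\<close>
  have maximal: "j = 0" if R: "R \<in> S" and P: "P \<in> D" "P \<notin> S" "T R \<in> dyadic_gen j P" for R P j
  proof (rule ccontr)
    assume j: "j \<noteq> 0"
    have RD: "R \<in> D" using R SD by blast
    \<comment> \<open>Generation 0 is \<open>R\<close> alone, which lies in \<open>S\<close>, so
      \<open>T R\<close> has a parent inside \<open>R\<close>.\<close>
    have "i R \<noteq> 0"
      using T[OF RD] dyadic_gen_0[OF cube[OF RD]] R by (metis singletonD)
    then have "i R - 1 + 1 = i R" "j - 1 + 1 = j" using j by simp_all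
    then have "T R \<in> dyadic_gen (i R - 1 + 1) R" "T R \<in> dyadic_gen (j - 1 + 1) P"
      using T[OF RD] P(3) by simp_all
    then obtain U V where U: "U \<in> dyadic_gen (i R - 1) R" "T R \<in> dyadic_gen 1 U"
      and V: "V \<in> dyadic_gen (j - 1) P" "T R \<in> dyadic_gen 1 V"
      unfolding dyadic_gen_add[OF cube[OF RD]] dyadic_gen_add[OF cube[OF P(1)]] by blast
    have "U = V"
      using dyadic_lattice_ancestor_unique[OF D _ _ U(2) V(2)]
        dyadic_lattice_gen[OF D RD U(1)] dyadic_lattice_gen[OF D P(1) V(1)] by blast
    moreover have "U \<in> S"
      using not_less_Least[of "i R - 1" "\<lambda>j. \<not> dyadic_gen j R \<subseteq> S"] \<open>i R \<noteq> 0\<close> U(1)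
      unfolding i_def by auto
    ultimately show False using parent_closed_ancestor[OF D par P(1) _ V(1)] P(2) by blast
  qed
  \<comment> \<open>Intersecting lattice cubes are nested, and maximality leaves no room for a
    proper inclusion.\<close>
  have T_eq: "T R = T R'" if R: "R \<in> S" "R' \<in> S" and "T R \<inter> T R' \<noteq> {}" for R R'
  proof -
    have sub: "T P = T P'" if P: "P \<in> S" "P' \<in> S" "T P \<in> dyadic_gen j (T P')" for P P' j
    proof -
      have *: "P' \<in> D" using P SD by blast
      have c: "is_cube (T P')" by (rule cube[OF TD[OF *]])
      have j: "j = 0" using maximal[OF P(1) TD[OF *] _ P(3)] T[OF *] by blast
      show ?thesis using dyadic_gen_0[OF c] P(3) j by simp
    qed
    have "T R \<in> D" "T R' \<in> D" using TD R SD by auto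
    then show ?thesis using dyadic_lattice_nested[OF D _ _ that(3)] sub R by metis
  qed
  \<comment> \<open>Going down \<open>m\<close> generations gives \<open>2 ^ (m * ?d)\<close>
    subcubes, more than \<open>m\<close>, hence enough for the \<open>m + 1\<close> indices.\<close>
  have "\<exists>e. e ` {..m} \<subseteq> dyadic_gen m Q \<and> inj_on e {..m}" if "Q \<in> D" for Q
  proof (rule card_le_inj)
    have "m < 2 ^ (m * ?d)"
      by (rule less_le_trans[OF less_exp]) (simp add: power_increasing)
    then show "card {..m} \<le> card (dyadic_gen m Q)"
      by (simp add: dyadic_gen_card[OF cube[OF that]])
  qed (use dyadic_gen_finite[OF cube[OF that]] in auto)
  then obtain e where e: "\<And>Q. Q \<in> D \<Longrightarrow> inj_on (e Q) {..m}"
    "\<And>Q. Q \<in> D \<Longrightarrow> e Q ` {..m} \<subseteq> dyadic_gen m Q" by metis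
  define M where "M R = e (T R) (i R)" for R
  have M: "M R \<in> dyadic_gen m (T R)" if "R \<in> D" for R
    unfolding M_def using e(2)[OF TD[OF that]] i_le[OF that] by auto
  have M': "M R \<in> dyadic_gen (i R + m) R" if "R \<in> D" for R
    unfolding dyadic_gen_add[OF cube[OF that]] using M[OF that] T[OF that] by blast
  show ?thesis
    unfolding well_sparse_def
  proof (intro exI conjI ballI impI)
    \<comment> \<open>\<open>M R\<close> lies \<open>i R + m\<close> generations below
      \<open>R\<close>, and \<open>i R\<close> is at most \<open>m\<close>, so the volume ratio is
      at most this constant.\<close>
    show "(2::real) ^ ((m + m) * ?d) > 1" using m by (intro one_less_power) auto
    fix R assume "R \<in> S"
    then have R: "R \<in> D" using SD by blast
    show "is_cube (M R)" "M R \<subseteq> R"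
      using dyadic_gen_is_cube[OF cube[OF R] M'[OF R]] dyadic_gen_subset[OF cube[OF R] M'[OF R]] .
    have "(2::real) ^ ((i R + m) * ?d) \<le> 2 ^ ((m + m) * ?d)"
      using i_le[OF R] by (intro power_increasing mult_right_mono) auto
    then have "vol R * 2 ^ ((i R + m) * ?d) \<le> vol R * 2 ^ ((m + m) * ?d)"
      by (intro mult_left_mono) auto
    then show "vol R \<le> 2 ^ ((m + m) * ?d) * vol (M R)"
      unfolding dyadic_gen_vol[OF cube[OF R] M'[OF R]] by (simp add: field_simps)
  next
    fix R R' assume S: "R \<in> S" "R' \<in> S" and ne: "R \<noteq> R'"
    have R: "R \<in> D" "R' \<in> D" using S SD by auto
    show "M R \<inter> M R' = {}"
    proof (rule ccontr)
      assume int: "M R \<inter> M R' \<noteq> {}"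
      have "T R \<inter> T R' \<noteq> {}"
        using dyadic_gen_subset[OF cube[OF TD[OF R(1)]] M[OF R(1)]]
          dyadic_gen_subset[OF cube[OF TD[OF R(2)]] M[OF R(2)]] int by blast
      then have eq: "T R = T R'" by (rule T_eq[OF S])
      have "M R = M R'"
        using dyadic_gen_eq[OF cube[OF TD[OF R(1)]] M[OF R(1)] _ int] M[OF R(2)] eq by simp
      \<comment> \<open>Injectivity of the numbering recovers the index; \<open>R\<close> and
        \<open>R'\<close> are then ancestors of one cube at the same distance.\<close>
      then have "i R = i R'"
        using e(1)[OF TD[OF R(1)]] eq i_le[OF R(1)] i_le[OF R(2)] by (simp add: M_def inj_on_def)
      then have "R = R'"
        using dyadic_lattice_ancestor_unique[OF D R] T[OF R(1)] T[OF R(2)] eq by metis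
      then show False using ne by simp
    qed
  qed
qed

theorem corollary4:
  fixes D S :: "(real ^ 'n) set set"
  assumes "dyadic_lattice D"
    and "S \<subseteq> D"
    and "Carleson D S"
    and "\<forall>Q\<in>S. parent D Q \<in> S"
  shows "well_sparse S \<and>
    (\<exists>(\<alpha>::real) (\<zeta>::real). \<alpha> > 0 \<and> \<zeta> > 0 \<and>
      (\<forall>R\<in>D. (\<Sum>\<^sub>\<infinity>Q\<in>{Q \<in> S. Q \<subseteq> R}. ennreal (vol Q powr (1 - \<alpha> / real CARD('n))))
              \<le> ennreal (\<zeta> * vol R powr (1 - \<alpha> / real CARD('n)))))"
proof -
  obtain m where m: "m > 0" and
    half: "\<And>R. R \<in> D \<Longrightarrow> 2 * card (S \<inter> dyadic_gen m R) \<le> 2 ^ (m * CARD('n))"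
    using Carleson_density_half[OF assms(1,2,4,3)] by metis
  \<comment> \<open>\<open>S\<close> holds at most half of a generation, which is not empty, so it
    misses a cube.\<close>
  have "\<not> dyadic_gen m R \<subseteq> S" if R: "R \<in> D" for R
  proof
    assume "dyadic_gen m R \<subseteq> S"
    then have "S \<inter> dyadic_gen m R = dyadic_gen m R" by blast
    then show False
      using half[OF R] dyadic_gen_card[OF dyadic_lattice_cube[OF assms(1) R], of m] by simp
  qed
  then have "well_sparse S" by (intro well_sparse_of_gaps[OF assms(1,2,4) _ m])
  then show ?thesis using power_sum_bound[OF assms(1,2,4) half m] by blast
qed

end
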